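(* Let $(X,\kappa)$ be a digital image that is a tree (as a graph). Then for every continuous $f:X\to X$, the set $\mathrm{Fix}(f)$ is $\kappa$-connected.
   Context: A digital image is a pair $(X,\kappa)$, where $X\subset\mathbb{Z}^m$ for some $m$ and $\kappa$ is an adjacency (a symmetric, irreflexive relation) on $X$; thus it is a simple graph with vertex set $X$. A subset of $X$ is $\kappa$-connected if the subgraph it induces is connected; the empty set is regarded as connected. A function $f:X\to X$ is continuous if whenever $x,y$ are adjacent, $f(x),f(y)$ are adjacent or equal. $\mathrm{Fix}(f)=\{x\in X\mid f(x)=x\}$. *)

theory Defs
  imports "HOL-Analysis.Finite_Cartesian_Product" "Graph_Theory.Digraph_Component"
begin

text \<open>The ambient dimension \<open>m\<close> of \<open>\<int>\<^sup>m\<close> is \<open>CARD('m)\<close>. Digital images may be infinite.\<close>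

definition digital_image :: "(int ^ 'm::finite) set \<Rightarrow> (int ^ 'm) rel \<Rightarrow> bool" where
  "digital_image X \<kappa> \<longleftrightarrow> \<kappa> \<subseteq> X \<times> X \<and> sym \<kappa> \<and> irrefl \<kappa>"

text \<open>An undirected edge is represented by its two orientations, both of which lie in \<open>\<kappa>\<close>.\<close>

definition image_graph :: "'a set \<Rightarrow> 'a rel \<Rightarrow> ('a, 'a \<times> 'a) pre_digraph" where
  "image_graph X \<kappa> = with_proj \<lparr>pverts = X, parcs = \<kappa>\<rparr>"

text \<open>The library predicate \<open>Digraph_Component.connected\<close> is false for the null graph,
  whereas here the empty set counts as connected.\<close>

definition image_connected :: "'a set \<Rightarrow> 'a rel \<Rightarrow> 'a set \<Rightarrow> bool" where
  "image_connected X \<kappa> A \<longleftrightarrow>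
     A \<subseteq> X \<and> (A = {} \<or> Digraph_Component.connected (image_graph X \<kappa> \<restriction> A))"

text \<open>The library predicate \<open>tree\<close> is meant for directed graphs: there, traversing an edge back
  and forth is a cycle of length 2, so a symmetric digraph with an edge never satisfies it.
  A cycle of a simple undirected graph is a directed cycle of length at least 3 in the
  associated symmetric digraph. The null graph is admitted as a tree.\<close>

definition image_tree :: "'a set \<Rightarrow> 'a rel \<Rightarrow> bool" where
  "image_tree X \<kappa> \<longleftrightarrow>
     image_connected X \<kappa> X \<and>
     \<not> (\<exists>p. pre_digraph.cycle (image_graph X \<kappa>) p \<and> 3 \<le> length p)"

definition image_continuous :: "'a set \<Rightarrow> 'a rel \<Rightarrow> ('a \<Rightarrow> 'a) \<Rightarrow> bool" where
  "image_continuous X \<kappa> f \<longleftrightarrow>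
     (\<forall>x\<in>X. \<forall>y\<in>X. (x, y) \<in> \<kappa> \<longrightarrow> (f x, f y) \<in> \<kappa> \<or> f x = f y)"

definition Fix :: "'a set \<Rightarrow> ('a \<Rightarrow> 'a) \<Rightarrow> 'a set" where
  "Fix X f = {x \<in> X. f x = x}"

end

theory Submission
  imports Defs
begin

text \<open>Let \<open>a\<close> and \<open>b\<close> be fixed points and let \<open>p\<close> be the second vertex of a shortest walk from \<open>a\<close>
  to \<open>b\<close>. The image under \<open>f\<close> of the rest of the walk joins \<open>f p\<close> to \<open>b\<close> and is no longer, so
  \<open>f p\<close> is a neighbour of \<open>a\<close> and, by minimality, both \<open>p\<close> and \<open>f p\<close> are joined to \<open>b\<close> by walks
  avoiding \<open>a\<close>. If \<open>f p\<close> were different from \<open>p\<close>, closing up through \<open>a\<close> would give a cycle.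
  Hence \<open>p\<close> is fixed, and induction on the distance to \<open>b\<close> finishes the proof.\<close>

text \<open>\<open>connected\<close> is strong connectedness of the symmetric closure. Closing adds
  nothing here, because \<kappa> already holds both orientations of every edge.\<close>

lemma arcs_ends_image_graph_induce:
  assumes "sym \<kappa>"
  shows "arcs_ends (with_proj (mk_symmetric (image_graph X \<kappa> \<restriction> A))) = Restr \<kappa> A"
  using assms by (auto simp: arcs_ends_conv mk_symmetric_def image_graph_def dest: symD)

lemma rtrancl_on_Restr:
  assumes "u \<in> A"
  shows "(u, v) \<in> rtrancl_on A (Restr \<kappa> A) \<longleftrightarrow> (u, v) \<in> (Restr \<kappa> A)\<^sup>*"
proof
  assume "(u, v) \<in> (Restr \<kappa> A)\<^sup>*"
  then show "(u, v) \<in> rtrancl_on A (Restr \<kappa> A)"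
    using assms by induction (auto intro: rtrancl_on_into_rtrancl_on)
qed (rule rtrancl_on_rtranclI)

lemma image_connected_iff_rtrancl:
  assumes "sym \<kappa>"
  shows "image_connected X \<kappa> A \<longleftrightarrow> A \<subseteq> X \<and> (\<forall>u\<in>A. \<forall>v\<in>A. (u, v) \<in> (Restr \<kappa> A)\<^sup>*)"
  using arcs_ends_image_graph_induce[OF assms, of X A]
  by (auto simp: image_connected_def connected_def strongly_connected_def reachable_def
      rtrancl_on_Restr)

lemma image_graph_simps:
  "verts (image_graph X \<kappa>) = X" "arcs (image_graph X \<kappa>) = \<kappa>"
  "tail (image_graph X \<kappa>) = fst" "head (image_graph X \<kappa>) = snd"
  by (simp_all add: image_graph_def)

lemma wf_digraph_image_graph:
  assumes "\<kappa> \<subseteq> X \<times> X"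
  shows "wf_digraph (image_graph X \<kappa>)"
  using assms by unfold_locales (auto simp: image_graph_def)

text \<open>A walk from \<open>p\<close> to \<open>q\<close> avoiding \<open>a\<close> can be
  thinned to a path. As \<open>p\<close> and \<open>q\<close> differ, it has at least one arc, so
  with the two arcs at \<open>a\<close> it closes to a cycle of length at least 3.\<close>

lemma cycle_through_vertex:
  assumes \<kappa>: "\<kappa> \<subseteq> X \<times> X"
    and ap: "(a, p) \<in> \<kappa>" "p \<noteq> a"
    and qa: "(q, a) \<in> \<kappa>" "q \<noteq> a"
    and "p \<noteq> q"
    and pq: "(p, q) \<in> (Restr \<kappa> (X - {a}))\<^sup>*"
  shows "\<exists>c. pre_digraph.cycle (image_graph X \<kappa>) c \<and> 3 \<le> length c"
proof -
  let ?G = "image_graph X \<kappa>"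
  \<comment> \<open>\<open>?H\<close> is the graph with \<open>a\<close> deleted, so every path
    found in it avoids \<open>a\<close>.\<close>
  let ?H = "image_graph (X - {a}) (Restr \<kappa> (X - {a}))"
  interpret G: wf_digraph ?G
    by (rule wf_digraph_image_graph[OF \<kappa>])
  interpret H: wf_digraph ?H
    by (rule wf_digraph_image_graph) auto
  have "p \<rightarrow>\<^sup>*\<^bsub>?H\<^esub> q"
    using \<kappa> ap pq
    by (auto simp: reachable_def image_graph_simps arcs_ends_conv rtrancl_on_Restr)
  then obtain r where r: "H.apath p r q"
    by (auto simp: H.reachable_apath)
  have sub: "subgraph ?H ?G"
    using G.wf_digraph H.wf_digraph
    by (auto simp: subgraph_def compatible_def image_graph_simps)
  have verts_eq: "H.awalk_verts = G.awalk_verts"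
    by (rule compatible_awalk_verts) (simp add: compatible_def image_graph_simps)
  have a_notin: "a \<notin> set (G.awalk_verts p r)"
  proof -
    have "set (H.awalk_verts p r) \<subseteq> verts ?H"
      using H.awalkI_apath[OF r] by (rule H.awalkE')
    moreover have "a \<notin> verts ?H"
      by (simp add: image_graph_simps)
    ultimately show ?thesis
      unfolding verts_eq by blast
  qed
  have rG: "G.apath p r q"
    using G.subgraph_apath_imp_apath[OF r sub] .
  then have "r \<noteq> []"
    using \<open>p \<noteq> q\<close> by (auto simp: G.apath_Nil_iff)
  define c where "c = (a, p) # r @ [(q, a)]"
  have rest: "G.awalk p (r @ [(q, a)]) a"
    using G.awalkI_apath[OF rG] qa \<kappa>
    by (intro G.awalk_appendI) (auto simp: G.awalk_simps image_graph_simps)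
  then have walk: "G.awalk a c a"
    using ap by (simp add: c_def G.awalk_Cons_iff image_graph_simps del: G.awalk_append_iff)
  \<comment> \<open>A cycle may repeat only its base point; dropping the first vertex leaves
    \<open>a\<close> once, at the end.\<close>
  have "tl (G.awalk_verts a c) = G.awalk_verts p r @ [a]"
    using G.awalk_verts_append[OF rest] by (simp add: c_def image_graph_simps)
  then have "distinct (tl (G.awalk_verts a c))"
    using rG a_notin by (simp add: G.apath_def)
  with walk have "G.cycle c"
    by (auto simp: G.cycle_def c_def)
  moreover have "3 \<le> length c"
    using \<open>r \<noteq> []\<close> by (cases r) (auto simp: c_def)
  ultimately show ?thesis
    by blast
qed

text \<open>A walk of length \<open>k\<close> to \<open>b\<close> that met \<open>a\<close> would
  contain a walk from \<open>a\<close> to \<open>b\<close> of length at most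
  \<open>k\<close>.\<close>

lemma relpow_avoiding:
  assumes "\<kappa> \<subseteq> X \<times> X"
    and "(p, b) \<in> \<kappa> ^^ k"
    and "\<And>j. j \<le> k \<Longrightarrow> (a, b) \<notin> \<kappa> ^^ j"
  shows "(p, b) \<in> (Restr \<kappa> (X - {a}))\<^sup>*"
  using assms(2,3)
proof (induction k arbitrary: p)
  case 0
  then show ?case by simp
next
  case (Suc k)
  from Suc.prems(1) obtain q where q: "(p, q) \<in> \<kappa>" "(q, b) \<in> \<kappa> ^^ k"
    by (meson relpow_Suc_D2)
  have "p \<noteq> a" "q \<noteq> a"
    using Suc.prems q by (auto simp del: relpow.simps)
  with q assms(1) have "(p, q) \<in> Restr \<kappa> (X - {a})"
    by auto
  moreover have "(q, b) \<in> (Restr \<kappa> (X - {a}))\<^sup>*"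
    using Suc.IH[OF q(2)] Suc.prems(2) by (metis le_SucI)
  ultimately show ?case
    by (rule converse_rtrancl_into_rtrancl)
qed

text \<open>The image of a walk is a walk once the edges that \<open>f\<close> collapses to a point
  are dropped; hence the bound instead of an equality of lengths.\<close>

lemma image_continuous_relpow:
  assumes "image_continuous X \<kappa> f" "\<kappa> \<subseteq> X \<times> X"
    and "(p, b) \<in> \<kappa> ^^ k"
  shows "\<exists>j\<le>k. (f p, f b) \<in> \<kappa> ^^ j"
  using assms(3)
proof (induction k arbitrary: p)
  case 0
  then show ?case by auto
next
  case (Suc k)
  from Suc.prems obtain q where q: "(p, q) \<in> \<kappa>" "(q, b) \<in> \<kappa> ^^ k"
    by (meson relpow_Suc_D2)
  from Suc.IH[OF q(2)] obtain j where j: "j \<le> k" "(f q, f b) \<in> \<kappa> ^^ j"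
    by blast
  have "(f p, f q) \<in> \<kappa> \<or> f p = f q"
    using assms(1,2) q(1) by (auto simp: image_continuous_def)
  then show ?case
    using j by (metis Suc_le_mono le_SucI relpow_Suc_I2)
qed

lemma fixed_points_joined:
  assumes \<kappa>: "\<kappa> \<subseteq> X \<times> X" "sym \<kappa>" "irrefl \<kappa>"
    and acyclic: "\<nexists>c. pre_digraph.cycle (image_graph X \<kappa>) c \<and> 3 \<le> length c"
    and cont: "image_continuous X \<kappa> f"
    and "a \<in> Fix X f" "b \<in> Fix X f"
    and "(a, b) \<in> \<kappa> ^^ n" "\<And>j. j < n \<Longrightarrow> (a, b) \<notin> \<kappa> ^^ j"
  shows "(a, b) \<in> (Restr \<kappa> (Fix X f))\<^sup>*"
  using assms(6,8,9)
proof (induction n arbitrary: a)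
  case 0
  then show ?case by simp
next
  case (Suc m)
  from Suc.prems(2) obtain p where p: "(a, p) \<in> \<kappa>" "(p, b) \<in> \<kappa> ^^ m"
    by (meson relpow_Suc_D2)
  have far: "(a, b) \<notin> \<kappa> ^^ j" if "j \<le> m" for j
    using Suc.prems(3) that by simp
  obtain j where j: "j \<le> m" "(f p, b) \<in> \<kappa> ^^ j"
    using image_continuous_relpow[OF cont \<kappa>(1) p(2)] \<open>b \<in> Fix X f\<close> by (auto simp: Fix_def)
  have "f p = p"
  proof (rule ccontr)
    assume "f p \<noteq> p"
    let ?R = "Restr \<kappa> (X - {a})"
    \<comment> \<open>Otherwise \<open>j\<close> would be the length of a walk from \<open>a\<close>
      to \<open>b\<close> with \<open>j \<le> m\<close>, against \<open>far\<close>.\<close>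
    have "f p \<noteq> a"
      using far j by blast
    with cont p(1) \<kappa>(1) Suc.prems(1) have afp: "(a, f p) \<in> \<kappa>"
      by (force simp: image_continuous_def Fix_def)
    have "(p, b) \<in> ?R\<^sup>*"
      using relpow_avoiding[OF \<kappa>(1) p(2)] far by blast
    moreover have "(f p, b) \<in> ?R\<^sup>*"
      using relpow_avoiding[OF \<kappa>(1) j(2)] far j(1) by (meson order_trans)
    \<comment> \<open>Symmetry lets the walk from \<open>f p\<close> to \<open>b\<close> be reversed
      and appended to the one from \<open>p\<close>.\<close>
    moreover have "sym (?R\<^sup>*)"
      using \<kappa>(2) by (intro sym_rtrancl) (auto simp: sym_def)
    ultimately have "(p, f p) \<in> ?R\<^sup>*"
      by (meson rtrancl_trans symD)
    moreover have "p \<noteq> a"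
      using p(1) \<kappa>(3) by (auto simp: irrefl_def)
    moreover have "(f p, a) \<in> \<kappa>"
      using afp \<kappa>(2) by (auto dest: symD)
    ultimately show False
      using cycle_through_vertex[OF \<kappa>(1) p(1)] \<open>f p \<noteq> p\<close> \<open>f p \<noteq> a\<close> acyclic by metis
  qed
  then have "p \<in> Fix X f"
    using p(1) \<kappa>(1) by (auto simp: Fix_def)
  \<comment> \<open>Prefixing the edge from \<open>a\<close> to \<open>p\<close> would give a walk
    from \<open>a\<close> shorter than \<open>Suc m\<close>.\<close>
  moreover have "(p, b) \<notin> \<kappa> ^^ i" if "i < m" for i
    using Suc.prems(3)[of "Suc i"] p(1) that by (meson Suc_less_eq relpow_Suc_I2)
  ultimately have "(p, b) \<in> (Restr \<kappa> (Fix X f))\<^sup>*"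
    using Suc.IH p(2) by blast
  moreover have "(a, p) \<in> Restr \<kappa> (Fix X f)"
    using p(1) Suc.prems(1) \<open>p \<in> Fix X f\<close> by simp
  ultimately show ?case
    by (rule converse_rtrancl_into_rtrancl[rotated])
qed

theorem corollary8p5:
  fixes X :: "(int ^ 'm::finite) set" and \<kappa> :: "(int ^ 'm) rel"
    and f :: "int ^ 'm \<Rightarrow> int ^ 'm"
  assumes "digital_image X \<kappa>"
    and "image_tree X \<kappa>"
    and "f \<in> X \<rightarrow> X"
    and "image_continuous X \<kappa> f"
  shows "image_connected X \<kappa> (Fix X f)"
proof -
  have \<kappa>: "\<kappa> \<subseteq> X \<times> X" "sym \<kappa>" "irrefl \<kappa>"
    using assms(1) by (auto simp: digital_image_def)
  have acyclic: "\<nexists>c. pre_digraph.cycle (image_graph X \<kappa>) c \<and> 3 \<le> length c"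
    using assms(2) by (simp add: image_tree_def)
  have "(a, b) \<in> (Restr \<kappa> (Fix X f))\<^sup>*" if a: "a \<in> Fix X f" and b: "b \<in> Fix X f" for a b
  proof -
    have "(a, b) \<in> (Restr \<kappa> X)\<^sup>*"
      using assms(2) a b image_connected_iff_rtrancl[OF \<kappa>(2), of X X]
      by (simp add: image_tree_def Fix_def)
    moreover have "Restr \<kappa> X = \<kappa>"
      using \<kappa>(1) by blast
    ultimately have walk: "\<exists>n. (a, b) \<in> \<kappa> ^^ n"
      by (simp add: rtrancl_power)
    \<comment> \<open>The least length of a walk, the distance from \<open>a\<close> to
      \<open>b\<close>, serves as \<open>n\<close>.\<close>
    show ?thesis
      using fixed_points_joined[OF \<kappa> acyclic assms(4) a b LeastI_ex[OF walk]] not_less_Least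
      by blast
  qed
  then show ?thesis
    by (simp add: image_connected_iff_rtrancl[OF \<kappa>(2)] Fix_def)
qed

end
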